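(* Call a rational number $x \in (0,1)$ an exception if $\log\Gamma(x) + \log\Gamma(1-x)$ is algebraic. Then exactly one of the following statements is true: (i) there are no exceptions, and hence $\log \pi$ is a transcendental number; (ii) there is exactly one exception, this exception is $x = \tfrac12$, and hence $\log\pi$ is an algebraic number; (iii) there are exactly two exceptions, both different from $\tfrac12$, and hence $\log\pi$ is a transcendental number.
   Context: $\Gamma$ is Euler's gamma function, $\Gamma(x) = \int_0^\infty e^{-t} t^{x-1}\,dt$ for $x>0$, and $\log$ denotes the natural logarithm. A real number is transcendental if it is not algebraic over $\mathbb{Q}$. *)

theory Defs
  imports "HOL-Analysis.Analysis" "HOL-Computational_Algebra.Polynomial"
begin

definition exception :: "real \<Rightarrow> bool" where
  "exception x \<longleftrightarrow> x \<in> \<rat> \<and> 0 < x \<and> x < 1 \<and>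
     algebraic (ln (Gamma x) + ln (Gamma (1 - x)))"

definition exceptions :: "real set" where
  "exceptions = {x. exception x}"

end

(*
  By Euler's reflection formula, log Gamma(x) + log Gamma(1 - x) = log pi - log sin(pi x).  If x and
  y are exceptions, then log (sin(pi x) / sin(pi y)) is algebraic, and since the sines are algebraic
  the Hermite-Lindemann theorem forces sin(pi x) = sin(pi y), that is y = x or y = 1 - x.

  Hermite-Lindemann is needed only for real alpha > 0.  Let beta = exp alpha be algebraic too.
  The divided difference of t |-> exp(t alpha) at 0, ..., d, each node taken p + 1 times, is positive
  and of size about 1 / ((d + 1) p)!.  The recursion for divided differences shows that p! C^p times
  it is a polynomial in alpha and beta with integer coefficients of size at most p! C^p.  Up to a
  factor C^p, such a number is an eigenvalue of an integer matrix of a fixed size n with entries of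
  size p! C^p, so its absolute value is at least C^(-p) / p!^n unless it is 0.  For d > n this is a
  contradiction as p tends to infinity.
*)

theory Submission
  imports Defs "HOL-Computational_Algebra.Formal_Power_Series" "Jordan_Normal_Form.Char_Poly"
begin

section \<open>Eigenvalues of integer matrices\<close>

text \<open>Majorants (the first argument) pass through sums and products, so the Leibniz expansion
  of a determinant can be bounded factor by factor; evaluation at 1 then turns the majorant into a
  number.\<close>

definition poly_majorizes :: "int poly \<Rightarrow> int poly \<Rightarrow> bool" where
  "poly_majorizes q p \<longleftrightarrow> (\<forall>i. \<bar>coeff p i\<bar> \<le> coeff q i)"

lemma poly_majorizes_add:
  "poly_majorizes q p \<Longrightarrow> poly_majorizes q' p' \<Longrightarrow> poly_majorizes (q + q') (p + p')"
  unfolding poly_majorizes_def by (auto intro!: order_trans[OF abs_triangle_ineq] add_mono)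

lemma poly_majorizes_0 [simp]: "poly_majorizes 0 0"
  by (simp add: poly_majorizes_def)

lemma poly_majorizes_1 [simp]: "poly_majorizes 1 1"
  by (simp add: poly_majorizes_def)

lemma poly_majorizes_mult:
  assumes "poly_majorizes q p" "poly_majorizes q' p'"
  shows "poly_majorizes (q * q') (p * p')"
  unfolding poly_majorizes_def
proof
  fix n
  have "\<bar>coeff (p * p') n\<bar> \<le> (\<Sum>i\<le>n. \<bar>coeff p i * coeff p' (n - i)\<bar>)"
    unfolding coeff_mult by (rule sum_abs)
  also have "\<dots> \<le> (\<Sum>i\<le>n. coeff q i * coeff q' (n - i))"
    using assms unfolding poly_majorizes_def
    by (intro sum_mono) (auto simp: abs_mult intro!: mult_mono intro: order_trans[OF abs_ge_zero])
  finally show "\<bar>coeff (p * p') n\<bar> \<le> coeff (q * q') n"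
    by (simp add: coeff_mult)
qed

lemma poly_majorizes_sum:
  "(\<And>x. x \<in> A \<Longrightarrow> poly_majorizes (q x) (p x)) \<Longrightarrow> poly_majorizes (sum q A) (sum p A)"
  by (induction A rule: infinite_finite_induct) (auto intro: poly_majorizes_add)

lemma poly_majorizes_prod:
  "(\<And>x. x \<in> A \<Longrightarrow> poly_majorizes (q x) (p x)) \<Longrightarrow> poly_majorizes (prod q A) (prod p A)"
  by (induction A rule: infinite_finite_induct)
     (auto intro: poly_majorizes_mult)

lemma sum_abs_coeff_le_majorant:
  assumes "poly_majorizes q p"
  shows "(\<Sum>i\<le>degree p. \<bar>coeff p i\<bar>) \<le> poly q 1"
proof -
  have nonneg: "coeff q i \<ge> 0" for i
    using assms unfolding poly_majorizes_def by (meson abs_ge_zero order_trans)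
  have "(\<Sum>i\<le>degree p. \<bar>coeff p i\<bar>) \<le> (\<Sum>i\<le>degree p. coeff q i)"
    using assms unfolding poly_majorizes_def by (intro sum_mono) auto
  \<comment> \<open>Summing up to the maximum of the degrees avoids comparing them.\<close>
  also have "\<dots> \<le> (\<Sum>i\<le>max (degree p) (degree q). coeff q i)"
    by (rule sum_mono2) (auto simp: nonneg)
  also have "\<dots> = (\<Sum>i\<le>degree q. coeff q i)"
    by (rule sum.mono_neutral_right) (auto simp: coeff_eq_0)
  finally show ?thesis
    by (simp add: poly_altdef)
qed

text \<open>The Leibniz formula has \<open>fact n\<close> terms, each up to sign a product of
  \<open>n\<close> entries of the characteristic matrix. Every entry is majorized by H + X, whose
  value at 1 is 1 + H.\<close>

lemma char_poly_coeff_bound: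
  fixes A :: "int mat"
  assumes A: "A \<in> carrier_mat n n" and H: "\<And>i j. i < n \<Longrightarrow> j < n \<Longrightarrow> \<bar>A $$ (i, j)\<bar> \<le> H"
    and "H \<ge> 0"
  shows "(\<Sum>i\<le>degree (char_poly A). \<bar>coeff (char_poly A) i\<bar>) \<le> fact n * (1 + H) ^ n"
proof -
  let ?C = "char_poly_matrix A"
  have C: "?C \<in> carrier_mat n n" using A by simp
  let ?q = "\<Sum>p\<in>{p. p permutes {0..<n}}. (\<Prod>i=0..<n. [:H, 1:])"
  have entry: "poly_majorizes [:H, 1:] (?C $$ (i, j))" if "i < n" "j < n" for i j
    using that A H[OF that] \<open>H \<ge> 0\<close>
    by (auto simp: char_poly_matrix_def poly_majorizes_def coeff_pCons split: nat.splits)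
  have "poly_majorizes ?q (char_poly A)"
    unfolding char_poly_def det_def'[OF C]
  proof (rule poly_majorizes_sum)
    fix p assume "p \<in> {p. p permutes {0..<n}}"
    hence p: "p permutes {0..<n}" by simp
    have less: "p i < n" if "i < n" for i
      using permutes_in_image[OF p, of i] that by simp
    have "poly_majorizes 1 (signof p :: int poly)"
      by (cases p rule: sign_cases) (auto simp: poly_majorizes_def)
    moreover have "poly_majorizes (\<Prod>i=0..<n. [:H, 1:]) (\<Prod>i=0..<n. ?C $$ (i, p i))"
      using less by (intro poly_majorizes_prod entry) auto
    ultimately have "poly_majorizes (1 * (\<Prod>i=0..<n. [:H, 1:])) (signof p * (\<Prod>i=0..<n. ?C $$ (i, p i)))"
      by (rule poly_majorizes_mult)
    thus "poly_majorizes (\<Prod>i=0..<n. [:H, 1:]) (signof p * (\<Prod>i=0..<n. ?C $$ (i, p i)))"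
      by simp
  qed
  moreover have "poly (fact n :: int poly) 1 = fact n"
    by (metis of_nat_fact poly_of_nat)
  ultimately show ?thesis using sum_abs_coeff_le_majorant[of ?q "char_poly A"]
    by (simp add: poly_sum poly_prod card_permutations add.commute)
qed

section \<open>Numbers that act by integer matrices\<close>

text \<open>
  The vector \<open>v\<close> makes \<open>x\<close> an eigenvalue of an integer matrix with entries bounded by \<open>H\<close>.
  The entries of \<open>v\<close> need not be linearly independent over the rationals, so no field degree
  ever has to be computed.
\<close>
definition acts_by_integers ::
  "'i set \<Rightarrow> ('i \<Rightarrow> 'a::field_char_0) \<Rightarrow> 'a \<Rightarrow> int \<Rightarrow> bool" where
  "acts_by_integers I v x H \<longleftrightarrow>
     (\<exists>M. (\<forall>i\<in>I. x * v i = (\<Sum>j\<in>I. of_int (M i j) * v j)) \<and> (\<forall>i\<in>I. \<forall>j\<in>I. \<bar>M i j\<bar> \<le> H))"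

text \<open>Numbering \<open>I\<close> turns \<open>v\<close> into an eigenvector, nonzero because
  of the entry at \<open>i0\<close>. The characteristic polynomial of the matrix is then a monic
  integer polynomial vanishing at \<open>x\<close>.\<close>

lemma acts_by_integers_monic_root:
  fixes x :: "'a :: field_char_0"
  assumes "acts_by_integers I v x H" "finite I" "i0 \<in> I" "v i0 \<noteq> 0" "H \<ge> 0"
  obtains p :: "int poly" where "lead_coeff p = 1" "poly (map_poly of_int p) x = 0"
    "(\<Sum>i\<le>degree p. \<bar>coeff p i\<bar>) \<le> fact (card I) * (1 + H) ^ card I"
proof -
  obtain M where M: "\<And>i. i \<in> I \<Longrightarrow> x * v i = (\<Sum>j\<in>I. of_int (M i j) * v j)"
    "\<And>i j. i \<in> I \<Longrightarrow> j \<in> I \<Longrightarrow> \<bar>M i j\<bar> \<le> H"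
    using assms(1) unfolding acts_by_integers_def by blast
  define n where "n = card I"
  obtain f where f: "bij_betw f {0..<n} I"
    using ex_bij_betw_nat_finite[OF \<open>finite I\<close>] n_def by blast
  have fI: "f i \<in> I" if "i < n" for i
    using f that by (auto simp: bij_betw_def)
  define A where "A = mat n n (\<lambda>(i, j). M (f i) (f j))"
  define w where "w = vec n (\<lambda>i. v (f i))"
  have A: "A \<in> carrier_mat n n" by (simp add: A_def)
  let ?B = "map_mat of_int A :: 'a mat"
  have B: "?B \<in> carrier_mat n n" using A by simp
  have "?B *\<^sub>v w = x \<cdot>\<^sub>v w"
  proof (rule eq_vecI)
    fix i assume "i < dim_vec (x \<cdot>\<^sub>v w)"
    hence i: "i < n" by (simp add: w_def)
    have "(?B *\<^sub>v w) $ i = (\<Sum>j=0..<n. of_int (M (f i) (f j)) * v (f j))"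
      using i by (simp add: scalar_prod_def A_def w_def)
    also have "\<dots> = (\<Sum>j\<in>I. of_int (M (f i) j) * v j)"
      by (rule sum.reindex_bij_betw[OF f])
    also have "\<dots> = (x \<cdot>\<^sub>v w) $ i"
      using i by (simp add: M(1)[OF fI] w_def)
    finally show "(?B *\<^sub>v w) $ i = (x \<cdot>\<^sub>v w) $ i" .
  qed (simp add: A_def w_def)
  moreover have "w \<noteq> 0\<^sub>v n"
  proof
    assume w0: "w = 0\<^sub>v n"
    obtain k where k: "k < n" "f k = i0"
      using f \<open>i0 \<in> I\<close> by (auto simp: bij_betw_def image_iff)
    have "w $ k = v i0" using k by (simp add: w_def)
    thus False using w0 k(1) \<open>v i0 \<noteq> 0\<close> by simp
  qed
  ultimately have "eigenvalue ?B x"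
    unfolding eigenvalue_def eigenvector_def using A by (intro exI[of _ w]) (auto simp: w_def)
  hence "poly (char_poly ?B) x = 0"
    using eigenvalue_root_char_poly[OF B] by simp
  hence "poly (map_poly of_int (char_poly A)) x = 0"
    using of_int_hom.char_poly_hom[OF A] by metis
  moreover have "lead_coeff (char_poly A) = 1"
    using degree_monic_char_poly[OF A] by simp
  moreover have "(\<Sum>i\<le>degree (char_poly A). \<bar>coeff (char_poly A) i\<bar>) \<le> fact n * (1 + H) ^ n"
    by (rule char_poly_coeff_bound[OF A]) (auto simp: A_def \<open>H \<ge> 0\<close> intro!: M(2) fI)
  ultimately show ?thesis
    using that n_def by blast
qed

text \<open>For |x| \<le> 1 the lowest nonzero coefficient is isolated: it is an integer of absolute
  value at least 1, and after division by the matching power of \<open>x\<close> all other terms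
  still contain a factor \<open>x\<close>. For |x| > 1 the leading coefficient alone
  suffices.\<close>

lemma monic_root_lower_bound:
  fixes x :: real and p :: "int poly"
  assumes "lead_coeff p = 1" "poly (map_poly of_int p) x = 0" "x \<noteq> 0"
  shows "1 \<le> \<bar>x\<bar> * (\<Sum>i\<le>degree p. \<bar>coeff p i\<bar>)"
proof (cases "\<bar>x\<bar> \<le> 1")
  case True
  define s where "s = (LEAST i. coeff p i \<noteq> 0)"
  have "coeff p (degree p) \<noteq> 0" using assms(1) by simp
  hence cs: "coeff p s \<noteq> 0" unfolding s_def by (rule LeastI)
  have below: "coeff p i = 0" if "i < s" for i
    using not_less_Least[OF that[unfolded s_def]] by simp
  have s: "s \<le> degree p" using cs by (rule le_degree)
  let ?c = "\<lambda>i. real_of_int (coeff p i)"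
  have "0 = (\<Sum>i\<le>degree p. ?c i * x ^ i)"
    using assms(2) by (simp add: poly_altdef)
  also have "\<dots> = ?c s * x ^ s + (\<Sum>i\<in>{..degree p} - {s}. ?c i * x ^ i)"
    using s by (subst sum.remove[of _ s]) auto
  finally have eq: "?c s * x ^ s = - (\<Sum>i\<in>{..degree p} - {s}. ?c i * x ^ i)"
    by simp
  have "\<bar>?c s\<bar> * \<bar>x\<bar> ^ s = \<bar>?c s * x ^ s\<bar>"
    by (simp add: abs_mult power_abs)
  also have "\<dots> \<le> (\<Sum>i\<in>{..degree p} - {s}. \<bar>?c i * x ^ i\<bar>)"
    unfolding eq abs_minus_cancel by (rule sum_abs)
  \<comment> \<open>Terms below \<open>s\<close> vanish; for those above \<open>s\<close>, a higher
    power of |x| is smaller since |x| \<le> 1.\<close>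
  also have "\<dots> \<le> (\<Sum>i\<in>{..degree p} - {s}. \<bar>?c i\<bar> * \<bar>x\<bar> ^ Suc s)"
  proof (rule sum_mono)
    fix i assume i: "i \<in> {..degree p} - {s}"
    show "\<bar>?c i * x ^ i\<bar> \<le> \<bar>?c i\<bar> * \<bar>x\<bar> ^ Suc s"
    proof (cases "i < s")
      case False
      hence "\<bar>x\<bar> ^ i \<le> \<bar>x\<bar> ^ Suc s" using i True by (intro power_decreasing) auto
      thus ?thesis by (simp add: abs_mult power_abs mult_left_mono)
    qed (simp add: below)
  qed
  also have "\<dots> \<le> (\<Sum>i\<le>degree p. \<bar>?c i\<bar> * \<bar>x\<bar> ^ Suc s)"
    by (rule sum_mono2) auto
  also have "\<dots> = (\<bar>x\<bar> * (\<Sum>i\<le>degree p. \<bar>?c i\<bar>)) * \<bar>x\<bar> ^ s"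
    by (simp add: sum_distrib_left sum_distrib_right mult_ac)
  finally have "\<bar>?c s\<bar> \<le> \<bar>x\<bar> * (\<Sum>i\<le>degree p. \<bar>?c i\<bar>)"
    using assms(3) by simp
  moreover have "1 \<le> \<bar>?c s\<bar>" using cs by linarith
  ultimately show ?thesis by simp
next
  case False
  have "\<bar>coeff p (degree p)\<bar> \<le> (\<Sum>i\<le>degree p. \<bar>coeff p i\<bar>)"
    by (rule member_le_sum) auto
  hence "1 \<le> (\<Sum>i\<le>degree p. \<bar>coeff p i\<bar>)" using assms(1) by simp
  hence "1 \<le> real_of_int (\<Sum>i\<le>degree p. \<bar>coeff p i\<bar>)" by (simp only: of_int_1_le_iff)
  hence "1 * 1 \<le> \<bar>x\<bar> * real_of_int (\<Sum>i\<le>degree p. \<bar>coeff p i\<bar>)"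
    using False by (intro mult_mono) auto
  thus ?thesis by simp
qed

text \<open>This is the Liouville inequality: a nonzero number of this kind cannot be much smaller
  than the inverse of the \<open>card I\<close>-th power of its entry bound.\<close>

lemma acts_by_integers_liouville:
  fixes x :: real
  assumes "acts_by_integers I v x H" "finite I" "i0 \<in> I" "v i0 \<noteq> 0" "H \<ge> 0" "x \<noteq> 0"
  shows "1 \<le> \<bar>x\<bar> * (fact (card I) * (1 + of_int H) ^ card I)"
proof -
  obtain p :: "int poly" where p: "lead_coeff p = 1" "poly (map_poly of_int p) x = 0"
    and le: "(\<Sum>i\<le>degree p. \<bar>coeff p i\<bar>) \<le> fact (card I) * (1 + H) ^ card I"
    by (rule acts_by_integers_monic_root[OF assms(1-5)])
  have "1 \<le> \<bar>x\<bar> * (\<Sum>i\<le>degree p. \<bar>coeff p i\<bar>)"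
    by (rule monic_root_lower_bound[OF p \<open>x \<noteq> 0\<close>])
  also have "\<dots> \<le> \<bar>x\<bar> * of_int (fact (card I) * (1 + H) ^ card I)"
    by (rule mult_left_mono) (use le in \<open>auto simp del: of_int_sum of_int_mult\<close>)
  finally show ?thesis by simp
qed

lemma acts_by_integers_mono:
  "acts_by_integers I v x H \<Longrightarrow> H \<le> H' \<Longrightarrow> acts_by_integers I v x H'"
  unfolding acts_by_integers_def by (meson order_trans)

lemma acts_by_integers_of_int:
  assumes "finite I"
  shows "acts_by_integers I v (of_int m) \<bar>m\<bar>"
  unfolding acts_by_integers_def
  by (rule exI[of _ "\<lambda>i j. if j = i then m else 0"])
     (auto simp: assms if_distrib[of of_int] if_distrib[of "\<lambda>x. x * _"] sum.delta' cong: if_cong)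

lemma acts_by_integers_add:
  assumes "acts_by_integers I v x H" "acts_by_integers I v y K"
  shows "acts_by_integers I v (x + y) (H + K)"
proof -
  obtain M where M: "\<And>i. i \<in> I \<Longrightarrow> x * v i = (\<Sum>j\<in>I. of_int (M i j) * v j)"
    "\<And>i j. i \<in> I \<Longrightarrow> j \<in> I \<Longrightarrow> \<bar>M i j\<bar> \<le> H"
    using assms(1) unfolding acts_by_integers_def by blast
  obtain N where N: "\<And>i. i \<in> I \<Longrightarrow> y * v i = (\<Sum>j\<in>I. of_int (N i j) * v j)"
    "\<And>i j. i \<in> I \<Longrightarrow> j \<in> I \<Longrightarrow> \<bar>N i j\<bar> \<le> K"
    using assms(2) unfolding acts_by_integers_def by blast
  show ?thesis unfolding acts_by_integers_def
    by (rule exI[of _ "\<lambda>i j. M i j + N i j"])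
       (auto simp: distrib_right sum.distrib M(1) N(1)
             intro!: order_trans[OF abs_triangle_ineq] add_mono M(2) N(2))
qed

text \<open>The matrices multiply, and each entry of the product is a sum of \<open>card I\<close>
  products.\<close>

lemma acts_by_integers_mult:
  assumes "finite I" "acts_by_integers I v x H" "acts_by_integers I v y K"
  shows "acts_by_integers I v (x * y) (int (card I) * H * K)"
proof -
  obtain M where M: "\<And>i. i \<in> I \<Longrightarrow> x * v i = (\<Sum>j\<in>I. of_int (M i j) * v j)"
    "\<And>i j. i \<in> I \<Longrightarrow> j \<in> I \<Longrightarrow> \<bar>M i j\<bar> \<le> H"
    using assms(2) unfolding acts_by_integers_def by blast
  obtain N where N: "\<And>i. i \<in> I \<Longrightarrow> y * v i = (\<Sum>j\<in>I. of_int (N i j) * v j)"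
    "\<And>i j. i \<in> I \<Longrightarrow> j \<in> I \<Longrightarrow> \<bar>N i j\<bar> \<le> K"
    using assms(3) unfolding acts_by_integers_def by blast
  have eq: "(x * y) * v i = (\<Sum>j\<in>I. of_int (\<Sum>k\<in>I. M i k * N k j) * v j)" if "i \<in> I" for i
  proof -
    have "(x * y) * v i = y * (x * v i)" by (simp add: mult_ac)
    also have "\<dots> = (\<Sum>k\<in>I. of_int (M i k) * (y * v k))"
      by (simp add: M(1)[OF that] sum_distrib_left mult_ac)
    also have "\<dots> = (\<Sum>k\<in>I. \<Sum>j\<in>I. of_int (M i k * N k j) * v j)"
      by (simp add: N(1) sum_distrib_left mult_ac)
    also have "\<dots> = (\<Sum>j\<in>I. \<Sum>k\<in>I. of_int (M i k * N k j) * v j)"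
      by (rule sum.swap)
    finally show ?thesis by (simp add: sum_distrib_right)
  qed
  have "\<bar>\<Sum>k\<in>I. M i k * N k j\<bar> \<le> int (card I) * H * K" if "i \<in> I" "j \<in> I" for i j
  proof -
    have "\<bar>\<Sum>k\<in>I. M i k * N k j\<bar> \<le> (\<Sum>k\<in>I. \<bar>M i k * N k j\<bar>)" by (rule sum_abs)
    also have "\<dots> \<le> (\<Sum>k\<in>I. H * K)"
      using that M(2) N(2) unfolding abs_mult
      by (intro sum_mono mult_mono) (auto intro: order_trans[OF abs_ge_zero])
    finally show ?thesis by simp
  qed
  with eq show ?thesis unfolding acts_by_integers_def
    by (intro exI[of _ "\<lambda>i j. \<Sum>k\<in>I. M i k * N k j"]) blast
qed

lemma acts_by_integers_power:
  assumes "finite I" "acts_by_integers I v x H"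
  shows "acts_by_integers I v (x ^ j) ((int (card I) * H) ^ j)"
proof (induction j)
  case 0
  show ?case using acts_by_integers_of_int[OF assms(1), of v 1] by simp
next
  case (Suc j)
  show ?case using acts_by_integers_mult[OF assms Suc] by simp
qed

lemma acts_by_integers_sum:
  assumes "finite I" "\<And>k. k \<in> A \<Longrightarrow> acts_by_integers I v (x k) (H k)"
  shows "acts_by_integers I v (sum x A) (sum H A)"
  using assms(2)
proof (induction A rule: infinite_finite_induct)
  case (insert k A)
  thus ?case by (simp add: acts_by_integers_add)
qed (use acts_by_integers_of_int[OF assms(1), of v 0] in auto)

lemma acts_by_integers_imp_algebraic:
  assumes "acts_by_integers I v x H" "finite I" "i0 \<in> I" "v i0 \<noteq> 0"
  shows "algebraic x"
proof -
  have "acts_by_integers I v x \<bar>H\<bar>" by (rule acts_by_integers_mono[OF assms(1)]) simp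
  then obtain p :: "int poly" where p: "lead_coeff p = 1" "poly (map_poly of_int p) x = 0"
    by (rule acts_by_integers_monic_root[where v = v and H = "\<bar>H\<bar>"]) (use assms in auto)
  have "p \<noteq> 0" using p(1) by auto
  show ?thesis by (rule algebraicI[OF _ _ p(2)]) (use \<open>p \<noteq> 0\<close> in auto)
qed

text \<open>This is a companion matrix. Scaling by the leading coefficient \<open>a\<close> of an
  integer polynomial of degree \<open>d\<close> makes the relation for x^d integral, so
  \<open>a * x\<close> acts on 1, ..., x^(d-1).\<close>

lemma algebraic_acts_on_powers:
  fixes x :: "'a :: field_char_0"
  assumes "algebraic x"
  obtains a :: int and d :: nat and H where "a \<noteq> 0" "d > 0"
    "acts_by_integers {..<d} (\<lambda>i. x ^ i) (of_int a * x) H"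
proof -
  obtain p :: "int poly" where p: "p \<noteq> 0" "poly (map_poly of_int p) x = 0"
    by (rule algebraicE'[OF assms])
  define d where "d = degree p"
  define a where "a = lead_coeff p"
  have "d > 0"
  proof (rule ccontr)
    assume "\<not> d > 0"
    then obtain c where "p = [:c:]" unfolding d_def using degree_eq_zeroE by blast
    thus False using p by auto
  qed
  have root: "of_int a * x ^ d = (\<Sum>j<d. of_int (- coeff p j) * x ^ j)"
  proof -
    have "0 = (\<Sum>j\<le>d. of_int (coeff p j) * x ^ j)"
      using p(2) by (simp add: poly_altdef d_def)
    also have "{..d} = insert d {..<d}" by auto
    finally have "0 = of_int a * x ^ d + (\<Sum>j<d. of_int (coeff p j) * x ^ j)"
      by (simp add: a_def d_def)
    thus ?thesis by (simp add: sum_negf eq_neg_iff_add_eq_0)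
  qed
  \<comment> \<open>The last row comes from the polynomial; every other row shifts the exponent by
    one with factor \<open>a\<close>.\<close>
  define M where "M = (\<lambda>i j. if i + 1 = d then - coeff p j else if j = i + 1 then a else 0)"
  define H where "H = (\<Sum>i<d. \<Sum>j<d. \<bar>M i j\<bar>)"
  have "of_int a * x * x ^ i = (\<Sum>j<d. of_int (M i j) * x ^ j)" if "i < d" for i
  proof (cases "i + 1 = d")
    case True
    hence "of_int a * x * x ^ i = of_int a * x ^ d" by (auto simp: mult_ac)
    thus ?thesis using True root by (simp add: M_def)
  next
    case False
    hence "(\<Sum>j<d. of_int (M i j) * x ^ j) = (\<Sum>j<d. if j = i + 1 then of_int a * x ^ j else 0)"
      by (intro sum.cong) (auto simp: M_def)
    also have "\<dots> = of_int a * x ^ (i + 1)" using False that by simp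
    finally show ?thesis by (simp add: mult_ac)
  qed
  moreover have "\<bar>M i j\<bar> \<le> H" if "i < d" "j < d" for i j
  proof -
    have "\<bar>M i j\<bar> \<le> (\<Sum>j<d. \<bar>M i j\<bar>)" using that by (intro member_le_sum) auto
    also have "\<dots> \<le> H" unfolding H_def using that
      by (intro member_le_sum[of i _ "\<lambda>i. \<Sum>j<d. \<bar>M i j\<bar>"]) (auto intro: sum_nonneg)
    finally show ?thesis .
  qed
  ultimately have "acts_by_integers {..<d} (\<lambda>i. x ^ i) (of_int a * x) H"
    unfolding acts_by_integers_def by (intro exI[of _ M]) auto
  moreover have "a \<noteq> 0" using p(1) by (simp add: a_def)
  ultimately show ?thesis using \<open>d > 0\<close> that by blast
qed

text \<open>The new matrix is the Kronecker product of the old one with the identity;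
  \<open>H \<ge> 0\<close> covers its zero entries.\<close>

lemma acts_by_integers_times_left:
  assumes "acts_by_integers I v x H" "finite I" "finite J" "H \<ge> 0"
  shows "acts_by_integers (I \<times> J) (\<lambda>(i, j). v i * w j) x H"
proof -
  obtain M where M: "\<And>i. i \<in> I \<Longrightarrow> x * v i = (\<Sum>j\<in>I. of_int (M i j) * v j)"
    "\<And>i j. i \<in> I \<Longrightarrow> j \<in> I \<Longrightarrow> \<bar>M i j\<bar> \<le> H"
    using assms(1) unfolding acts_by_integers_def by blast
  let ?N = "\<lambda>q r. if snd r = snd q then M (fst q) (fst r) else 0"
  have "x * (v i * w j) = (\<Sum>r\<in>I \<times> J. of_int (?N (i, j) r) * (v (fst r) * w (snd r)))"
    if "i \<in> I" "j \<in> J" for i j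
  proof -
    have "(\<Sum>r\<in>I \<times> J. of_int (?N (i, j) r) * (v (fst r) * w (snd r))) =
          (\<Sum>(k, l)\<in>I \<times> J. if l = j then of_int (M i k) * (v k * w l) else 0)"
      by (intro sum.cong) auto
    also have "\<dots> = (\<Sum>k\<in>I. \<Sum>l\<in>J. if l = j then of_int (M i k) * (v k * w l) else 0)"
      by (rule sum.cartesian_product[symmetric])
    also have "\<dots> = (\<Sum>k\<in>I. of_int (M i k) * (v k * w j))"
      using that assms by simp
    also have "\<dots> = (x * v i) * w j"
      by (simp add: M(1)[OF that(1)] sum_distrib_right sum_distrib_left mult_ac)
    finally show ?thesis by (simp add: mult_ac)
  qed
  thus ?thesis using M(2) \<open>H \<ge> 0\<close> unfolding acts_by_integers_def
    by (intro exI[of _ ?N]) (auto simp: case_prod_unfold)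
qed

lemma acts_by_integers_times_right:
  assumes "acts_by_integers J w x H" "finite I" "finite J" "H \<ge> 0"
  shows "acts_by_integers (I \<times> J) (\<lambda>(i, j). v i * w j) x H"
proof -
  obtain M where M: "\<And>i. i \<in> J \<Longrightarrow> x * w i = (\<Sum>j\<in>J. of_int (M i j) * w j)"
    "\<And>i j. i \<in> J \<Longrightarrow> j \<in> J \<Longrightarrow> \<bar>M i j\<bar> \<le> H"
    using assms(1) unfolding acts_by_integers_def by blast
  let ?N = "\<lambda>q r. if fst r = fst q then M (snd q) (snd r) else 0"
  have "x * (v i * w j) = (\<Sum>r\<in>I \<times> J. of_int (?N (i, j) r) * (v (fst r) * w (snd r)))"
    if "i \<in> I" "j \<in> J" for i j
  proof -
    have "(\<Sum>r\<in>I \<times> J. of_int (?N (i, j) r) * (v (fst r) * w (snd r))) =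
          (\<Sum>(k, l)\<in>I \<times> J. if k = i then of_int (M j l) * (v k * w l) else 0)"
      by (intro sum.cong) auto
    also have "\<dots> = (\<Sum>k\<in>I. \<Sum>l\<in>J. if k = i then of_int (M j l) * (v k * w l) else 0)"
      by (rule sum.cartesian_product[symmetric])
    also have "\<dots> = (\<Sum>k\<in>I. if k = i then \<Sum>l\<in>J. of_int (M j l) * (v k * w l) else 0)"
      by (intro sum.cong) auto
    also have "\<dots> = (\<Sum>l\<in>J. of_int (M j l) * (v i * w l))"
      using that assms by simp
    also have "\<dots> = v i * (x * w j)"
      by (simp add: M(1)[OF that(2)] sum_distrib_left mult_ac)
    finally show ?thesis by (simp add: mult_ac)
  qed
  thus ?thesis using M(2) \<open>H \<ge> 0\<close> unfolding acts_by_integers_def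
    by (intro exI[of _ ?N]) (auto simp: case_prod_unfold)
qed

text \<open>On the products x^i y^j both numbers act simultaneously, and hence so does every integer
  polynomial in their multiples. The entry at (0, 0) is 1 and serves as the nonzero one.\<close>

lemma algebraic_common_action:
  fixes x y :: "'a :: field_char_0"
  assumes "algebraic x" "algebraic y"
  obtains a b :: int and I :: "(nat \<times> nat) set" and v H i0 where
    "a \<noteq> 0" "b \<noteq> 0" "finite I" "i0 \<in> I" "v i0 \<noteq> 0" "H \<ge> 1"
    "acts_by_integers I v (of_int a * x) H" "acts_by_integers I v (of_int b * y) H"
proof -
  obtain a :: int and d H where a: "a \<noteq> 0" "d > 0"
    "acts_by_integers {..<d} (\<lambda>i. x ^ i) (of_int a * x) H"
    by (rule algebraic_acts_on_powers[OF assms(1)])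
  obtain b :: int and e K where b: "b \<noteq> 0" "e > 0"
    "acts_by_integers {..<e} (\<lambda>i. y ^ i) (of_int b * y) K"
    by (rule algebraic_acts_on_powers[OF assms(2)])
  let ?I = "{..<d} \<times> {..<e}"
  let ?v = "\<lambda>(i, j). x ^ i * y ^ j"
  let ?H = "max 1 (max H K)"
  have "acts_by_integers ?I ?v (of_int a * x) ?H"
    by (intro acts_by_integers_times_left acts_by_integers_mono[OF a(3)]) auto
  moreover have "acts_by_integers ?I ?v (of_int b * y) ?H"
    by (intro acts_by_integers_times_right acts_by_integers_mono[OF b(3)]) auto
  ultimately show ?thesis
    using that[of a b ?I "(0, 0)" ?v ?H] a b by auto
qed

section \<open>Closure of the algebraic numbers under ring operations\<close>

lemma algebraic_of_int_mult_cancel: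
  fixes x :: "'a :: field_char_0"
  assumes "algebraic (of_int c * x)" "c \<noteq> 0"
  shows "algebraic x"
proof -
  obtain p :: "'a poly" where p: "\<And>i. coeff p i \<in> \<int>" "p \<noteq> 0" "poly p (of_int c * x) = 0"
    using assms(1) unfolding algebraic_def by blast
  let ?q = "pcompose p [:0, of_int c:]"
  show ?thesis
  proof (rule algebraicI)
    show "coeff ?q i \<in> \<int>" for i
      using p(1) by (auto simp: coeff_pcompose_linear)
    show "?q \<noteq> 0" using p(2) assms(2) by (simp add: pcompose_eq_0_iff)
    show "poly ?q x = 0" using p(3) by (simp add: poly_pcompose mult.commute)
  qed
qed

lemma algebraic_mult:
  fixes x y :: "'a :: field_char_0"
  assumes "algebraic x" "algebraic y"
  shows "algebraic (x * y)"
proof -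
  obtain a b :: int and I :: "(nat \<times> nat) set" and v H i0 where
    I: "a \<noteq> 0" "b \<noteq> 0" "finite I" "i0 \<in> I" "v i0 \<noteq> 0" "H \<ge> 1"
    "acts_by_integers I v (of_int a * x) H" "acts_by_integers I v (of_int b * y) H"
    by (rule algebraic_common_action[OF assms])
  have "algebraic (of_int a * x * (of_int b * y))"
    by (rule acts_by_integers_imp_algebraic[OF acts_by_integers_mult[OF I(3,7,8)] I(3-5)])
  hence "algebraic (of_int (a * b) * (x * y))" by (simp add: mult_ac)
  thus ?thesis by (rule algebraic_of_int_mult_cancel) (use I in auto)
qed

lemma algebraic_add:
  fixes x y :: "'a :: field_char_0"
  assumes "algebraic x" "algebraic y"
  shows "algebraic (x + y)"
proof -
  obtain a b :: int and I :: "(nat \<times> nat) set" and v H i0 where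
    I: "a \<noteq> 0" "b \<noteq> 0" "finite I" "i0 \<in> I" "v i0 \<noteq> 0" "H \<ge> 1"
    "acts_by_integers I v (of_int a * x) H" "acts_by_integers I v (of_int b * y) H"
    by (rule algebraic_common_action[OF assms])
  \<comment> \<open>Scaling the two actions by \<open>b\<close> and \<open>a\<close> gives both
    summands the common denominator \<open>a * b\<close>.\<close>
  note m = acts_by_integers_mult[OF I(3) acts_by_integers_of_int[OF I(3)]]
  have "algebraic (of_int b * (of_int a * x) + of_int a * (of_int b * y))"
    by (rule acts_by_integers_imp_algebraic[OF acts_by_integers_add[OF m[OF I(7)] m[OF I(8)]] I(3-5)])
  hence "algebraic (of_int (a * b) * (x + y))" by (simp add: algebra_simps)
  thus ?thesis by (rule algebraic_of_int_mult_cancel) (use I in auto)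
qed

lemma algebraic_diff:
  fixes x y :: "'a :: field_char_0"
  assumes "algebraic x" "algebraic y"
  shows "algebraic (x - y)"
  using algebraic_add[OF assms(1) algebraic_minus[OF assms(2)]] by simp

section \<open>Divided differences of the exponential function\<close>

text \<open>
  The coefficients of \<open>complete_fps K\<close> are the complete homogeneous symmetric polynomials in the
  elements of \<open>K\<close>, so that \<open>divided_exp K z\<close> is the confluent divided difference of
  \<open>\<lambda>t. exp (t * z)\<close> at the nodes \<open>K\<close> (for nonempty \<open>K\<close>).
\<close>
definition complete_fps :: "nat multiset \<Rightarrow> real fps" where
  "complete_fps K = (\<Prod>k\<in>#K. Abs_fps (\<lambda>m. real k ^ m))"

definition divided_exp :: "nat multiset \<Rightarrow> real \<Rightarrow> real" where
  "divided_exp K z =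
     (\<Sum>m. fps_nth (complete_fps K) m * z ^ (m + (size K - 1)) / fact (m + (size K - 1)))"

lemma complete_fps_add_mset:
  "complete_fps (add_mset k K) = Abs_fps (\<lambda>m. real k ^ m) * complete_fps K"
  by (simp add: complete_fps_def)

lemma complete_fps_nth_add_mset:
  "fps_nth (complete_fps (add_mset k K)) m = (\<Sum>i\<le>m. real k ^ i * fps_nth (complete_fps K) (m - i))"
  by (simp add: complete_fps_add_mset fps_mult_nth atLeast0AtMost)

lemma complete_fps_nth_nonneg: "fps_nth (complete_fps K) m \<ge> 0"
proof (induction K arbitrary: m)
  case empty
  show ?case by (simp add: complete_fps_def)
next
  case (add k K)
  thus ?case by (auto simp: complete_fps_nth_add_mset intro!: sum_nonneg)
qed

lemma complete_fps_nth_0: "fps_nth (complete_fps K) 0 = 1"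
proof (induction K)
  case empty
  show ?case by (simp add: complete_fps_def)
next
  case (add k K)
  thus ?case by (simp add: complete_fps_nth_add_mset)
qed

text \<open>A complete homogeneous polynomial of degree m in s variables has at most 2^(m+s)
  monomials, each at most d^m here. The induction sees this as a geometric sum that doubles the
  constant with each node.\<close>

lemma complete_fps_nth_le:
  assumes "\<And>k. k \<in># K \<Longrightarrow> k \<le> d"
  shows "fps_nth (complete_fps K) m \<le> 2 ^ size K * (2 * real d) ^ m"
  using assms
proof (induction K arbitrary: m)
  case empty
  show ?case by (simp add: complete_fps_def)
next
  case (add k K)
  have "fps_nth (complete_fps (add_mset k K)) m \<le>
        (\<Sum>i\<le>m. real d ^ i * (2 ^ size K * (2 * real d) ^ (m - i)))"
    unfolding complete_fps_nth_add_mset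
    using add by (intro sum_mono mult_mono power_mono complete_fps_nth_nonneg) auto
  also have "\<dots> = (\<Sum>i\<le>m. 2 ^ size K * real d ^ m * 2 ^ (m - i))"
    by (intro sum.cong refl) (simp add: power_mult_distrib power_add[symmetric] mult_ac)
  also have "\<dots> = 2 ^ size K * real d ^ m * (\<Sum>i\<le>m. 2 ^ (m - i))"
    by (simp add: sum_distrib_left)
  also have "(\<Sum>i\<le>m. 2 ^ (m - i)) = (\<Sum>i\<le>m. 2 ^ i :: real)"
    by (rule sum.reindex_bij_witness[of _ "\<lambda>i. m - i" "\<lambda>i. m - i"]) auto
  also have "2 ^ size K * real d ^ m * \<dots> \<le> 2 ^ size K * real d ^ m * (2 * 2 ^ m)"
    using geometric_sum[of "2 :: real" "Suc m"]
    by (intro mult_left_mono) (simp_all add: lessThan_Suc_atMost)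
  finally show ?case
    by (simp add: power_mult_distrib mult_ac)
qed

text \<open>In generating functions this is 1/(1-kX) - 1/(1-iX) = (k-i) X / ((1-kX)(1-iX)),
  multiplied by the series of \<open>R\<close>.\<close>

lemma complete_fps_recursion:
  "(real k - real i) * fps_nth (complete_fps (add_mset k (add_mset i R))) m =
   fps_nth (complete_fps (add_mset k R)) (Suc m) - fps_nth (complete_fps (add_mset i R)) (Suc m)"
proof -
  let ?G = "\<lambda>k. Abs_fps (\<lambda>m. real k ^ m)"
  have geo: "(1 - fps_const (real k) * fps_X) * ?G k = 1" for k
    by (rule fps_ext) (auto simp: left_diff_distrib mult.assoc fps_X_mult_nth power_eq_if)
  have "?G k - ?G i = ?G k * ((1 - fps_const (real i) * fps_X) * ?G i) -
                      ?G i * ((1 - fps_const (real k) * fps_X) * ?G k)"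
    by (simp only: geo mult_1_right)
  also have "\<dots> = (fps_const (real k) - fps_const (real i)) * (fps_X * (?G k * ?G i))"
    by (simp add: algebra_simps del: fps_const_sub)
  finally have "(?G k - ?G i) * complete_fps R =
      fps_const (real k - real i) * (fps_X * complete_fps (add_mset k (add_mset i R)))"
    by (simp add: complete_fps_add_mset mult_ac)
  hence "fps_nth ((?G k - ?G i) * complete_fps R) (Suc m) =
      (real k - real i) * fps_nth (complete_fps (add_mset k (add_mset i R))) m"
    by simp
  thus ?thesis by (simp add: left_diff_distrib complete_fps_add_mset)
qed

text \<open>Since m! w! \<le> (m+w)!, the factor 1/w! splits off and what remains is a term of an
  exponential series.\<close>

lemma divided_exp_term_le:
  assumes "\<And>k. k \<in># K \<Longrightarrow> k \<le> d"
  shows "\<bar>fps_nth (complete_fps K) m * z ^ (m + w) / fact (m + w)\<bar> \<le>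
         2 ^ size K * \<bar>z\<bar> ^ w / fact w * ((2 * real d * \<bar>z\<bar>) ^ m / fact m)"
proof -
  have "fact m * fact w \<le> (fact (m + w) :: nat)"
    by (rule dvd_imp_le[OF fact_fact_dvd_fact]) simp
  hence f: "fact m * fact w \<le> (fact (m + w) :: real)"
    by (metis of_nat_fact of_nat_le_iff of_nat_mult)
  have "\<bar>fps_nth (complete_fps K) m * z ^ (m + w) / fact (m + w)\<bar> =
        fps_nth (complete_fps K) m * \<bar>z\<bar> ^ (m + w) / fact (m + w)"
    using complete_fps_nth_nonneg by (simp add: abs_mult power_abs)
  also have "\<dots> \<le> (2 ^ size K * (2 * real d) ^ m) * \<bar>z\<bar> ^ (m + w) / (fact m * fact w)"
    using f by (intro frac_le mult_right_mono complete_fps_nth_le assms) auto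
  finally show ?thesis by (simp add: power_add power_mult_distrib mult_ac)
qed

lemma sums_exp_power: "(\<lambda>m. y ^ m / fact m) sums exp (y :: real)"
  using exp_converges[of y] by (simp add: divide_inverse mult.commute)

lemma divided_exp_sums:
  "(\<lambda>m. fps_nth (complete_fps K) m * z ^ (m + (size K - 1)) / fact (m + (size K - 1)))
     sums divided_exp K z"
proof -
  have le: "k \<le> Max (set_mset K)" if "k \<in># K" for k using that by simp
  have "summable (\<lambda>m. fps_nth (complete_fps K) m * z ^ (m + (size K - 1)) / fact (m + (size K - 1)))"
  proof (rule summable_comparison_test'[OF summable_mult[OF sums_summable[OF sums_exp_power]]])
    fix m
    show "norm (fps_nth (complete_fps K) m * z ^ (m + (size K - 1)) / fact (m + (size K - 1))) \<le>
      2 ^ size K * \<bar>z\<bar> ^ (size K - 1) / fact (size K - 1) *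
        ((2 * real (Max (set_mset K)) * \<bar>z\<bar>) ^ m / fact m)"
      unfolding real_norm_def by (rule divided_exp_term_le[OF le])
  qed
  thus ?thesis unfolding divided_exp_def by (rule summable_sums)
qed

text \<open>All terms are nonnegative and the one for m = 0 is positive. This positivity is what
  later makes the auxiliary number nonzero.\<close>

lemma divided_exp_pos:
  assumes "z > 0"
  shows "divided_exp K z > 0"
proof -
  have "0 < (\<Sum>m. fps_nth (complete_fps K) m * z ^ (m + (size K - 1)) / fact (m + (size K - 1)))"
    using divided_exp_sums[of K z] complete_fps_nth_nonneg assms
    by (intro suminf_pos2[of _ 0]) (auto simp: sums_iff complete_fps_nth_0)
  thus ?thesis by (simp add: divided_exp_def)
qed

lemma divided_exp_le:
  assumes "\<And>k. k \<in># K \<Longrightarrow> k \<le> d" "z > 0"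
  shows "divided_exp K z \<le> 2 ^ size K * z ^ (size K - 1) / fact (size K - 1) * exp (2 * real d * z)"
proof (rule sums_le[OF _ divided_exp_sums sums_mult[OF sums_exp_power]])
  fix m
  show "fps_nth (complete_fps K) m * z ^ (m + (size K - 1)) / fact (m + (size K - 1)) \<le>
        2 ^ size K * z ^ (size K - 1) / fact (size K - 1) * ((2 * real d * z) ^ m / fact m)"
    using divided_exp_term_le[OF assms(1), of K m z "size K - 1"] assms(2)
    by (simp only: abs_of_pos abs_le_iff)
qed

lemma divided_exp_recursion:
  "(real k - real i) * divided_exp (add_mset k (add_mset i R)) z =
   divided_exp (add_mset k R) z - divided_exp (add_mset i R) z"
proof -
  let ?h = "\<lambda>K. fps_nth (complete_fps K)" and ?r = "size R"
  define f where "f = (\<lambda>m. ?h (add_mset k R) m * z ^ (m + ?r) / fact (m + ?r)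
              - ?h (add_mset i R) m * z ^ (m + ?r) / fact (m + ?r))"
  have "f sums (divided_exp (add_mset k R) z - divided_exp (add_mset i R) z)"
    unfolding f_def using divided_exp_sums[of "add_mset k R" z] divided_exp_sums[of "add_mset i R" z]
    by (intro sums_diff) simp_all
  \<comment> \<open>Both constant coefficients are 1 and cancel; the index shift then supplies the
    extra power of \<open>z\<close> that the larger multiset requires.\<close>
  moreover have "f 0 = 0" by (simp add: f_def complete_fps_nth_0)
  ultimately have "(\<lambda>m. f (Suc m)) sums (divided_exp (add_mset k R) z - divided_exp (add_mset i R) z)"
    using sums_Suc_iff[of f] by simp
  moreover have "f (Suc m) = (real k - real i) *
      (?h (add_mset k (add_mset i R)) m * z ^ (m + Suc ?r) / fact (m + Suc ?r))" for m
    unfolding f_def times_divide_eq_right mult.assoc[symmetric] complete_fps_recursion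
    by (simp only: diff_divide_distrib left_diff_distrib add_Suc add_Suc_right)
  ultimately have "(\<lambda>m. (real k - real i) *
      (?h (add_mset k (add_mset i R)) m * z ^ (m + Suc ?r) / fact (m + Suc ?r))) sums
      (divided_exp (add_mset k R) z - divided_exp (add_mset i R) z)"
    by simp
  moreover have "(\<lambda>m. (real k - real i) *
      (?h (add_mset k (add_mset i R)) m * z ^ (m + Suc ?r) / fact (m + Suc ?r))) sums
      ((real k - real i) * divided_exp (add_mset k (add_mset i R)) z)"
    using divided_exp_sums[of "add_mset k (add_mset i R)" z] by (intro sums_mult) simp
  ultimately show ?thesis by (rule sums_unique2[symmetric])
qed

text \<open>These are the coefficients of 1/(1-kX)^(q+1); the induction step is a hockey-stick
  sum.\<close>

lemma complete_fps_replicate_nth: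
  "fps_nth (complete_fps (replicate_mset (Suc q) k)) m = real ((m + q) choose q) * real k ^ m"
proof (induction q arbitrary: m)
  case 0
  show ?case by (simp add: complete_fps_def)
next
  case (Suc q)
  have "fps_nth (complete_fps (replicate_mset (Suc (Suc q)) k)) m =
        (\<Sum>i\<le>m. real k ^ i * (real ((m - i + q) choose q) * real k ^ (m - i)))"
    by (subst replicate_mset_Suc, subst complete_fps_nth_add_mset, subst Suc) simp
  also have "\<dots> = (\<Sum>i\<le>m. real ((m - i + q) choose q) * real k ^ m)"
    by (intro sum.cong refl) (simp add: mult_ac flip: power_add)
  also have "\<dots> = (\<Sum>i\<le>m. real ((i + q) choose q)) * real k ^ m"
    unfolding sum_distrib_right
    by (rule sum.reindex_bij_witness[of _ "\<lambda>i. m - i" "\<lambda>i. m - i"]) auto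
  also have "(\<Sum>i\<le>m. real ((i + q) choose q)) = real (\<Sum>i\<le>m. (q + i) choose q)"
    by (simp add: add.commute)
  also have "(\<Sum>i\<le>m. (q + i) choose q) = (q + m + 1) choose (q + 1)"
    by (rule choose_rising_sum(1))
  finally show ?case by (simp add: add.commute)
qed

text \<open>At a single node of multiplicity q + 1, a divided difference is the q-th derivative over
  q!.\<close>

lemma divided_exp_replicate:
  "divided_exp (replicate_mset (Suc q) k) z = z ^ q / fact q * exp (real k * z)"
proof -
  have "real ((m + q) choose q) * real k ^ m * z ^ (m + q) / fact (m + q) =
        z ^ q / fact q * ((real k * z) ^ m / fact m)" for m
    by (simp add: binomial_fact power_add power_mult_distrib field_simps)
  moreover have "(\<lambda>m. z ^ q / fact q * ((real k * z) ^ m / fact m)) sums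
     (z ^ q / fact q * exp (real k * z))"
    by (intro sums_mult sums_exp_power)
  moreover have "(\<lambda>m. real ((m + q) choose q) * real k ^ m * z ^ (m + q) / fact (m + q)) sums
     divided_exp (replicate_mset (Suc q) k) z"
    using divided_exp_sums[of "replicate_mset (Suc q) k" z]
    by (simp only: complete_fps_replicate_nth) simp
  ultimately show ?thesis by (metis (no_types, lifting) ext sums_unique2)
qed

text \<open>As long as two nodes differ, the recursion removes one of them. It divides by a node
  difference, which \<open>fact d\<close> clears, and subtracts two expansions, which doubles the
  bound: hence \<open>2 * fact d\<close> per node. When all nodes coincide, \<open>fact p\<close>
  clears the remaining factorial.\<close>

lemma divided_exp_expansion:
  assumes "K \<noteq> {#}" "\<And>k. k \<in># K \<Longrightarrow> k \<le> d" "\<And>k. count K k \<le> Suc p"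
  shows "\<exists>c :: nat \<Rightarrow> nat \<Rightarrow> int. (\<forall>l j. \<bar>c l j\<bar> \<le> fact p * (2 * fact d) ^ size K) \<and>
    (\<forall>z. fact p * fact d ^ size K * divided_exp K z =
         (\<Sum>k\<le>d. \<Sum>j\<le>p. of_int (c k j) * z ^ j * exp (real k * z)))"
  using assms
proof (induction K rule: measure_induct_rule[where f = size])
  case (less K)
  obtain k where k: "k \<in># K" using less.prems(1) by auto
  show ?case
  proof (cases "\<exists>i. i \<in># K \<and> i \<noteq> k")
    case False
    hence "K = replicate_mset (count K k) k"
      by (intro multiset_eqI) (auto simp: not_in_iff)
    moreover obtain q where q: "count K k = Suc q"
      using k by (metis count_eq_zero_iff not0_implies_Suc)
    ultimately have K: "K = replicate_mset (Suc q) k" by simp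
    have "q \<le> p" using less.prems(3)[of k] q by simp
    have "k \<le> d" using less.prems(2)[OF k] .
    \<comment> \<open>An exact division, because \<open>q \<le> p\<close>.\<close>
    define s :: nat where "s = fact p div fact q * fact d ^ size K"
    have dvd: "fact q dvd (fact p :: nat)" using \<open>q \<le> p\<close> by (rule fact_dvd)
    have "real s = fact p / fact q * fact d ^ size K"
      using dvd by (simp add: s_def real_of_nat_div)
    hence id: "fact p * fact d ^ size K * divided_exp K z = real s * z ^ q * exp (real k * z)" for z
      unfolding K divided_exp_replicate by simp
    define c where "c = (\<lambda>i j. if i = k \<and> j = q then int s else 0)"
    have sum: "(\<Sum>i\<le>d. \<Sum>j\<le>p. of_int (c i j) * z ^ j * exp (real i * z)) =
      real s * z ^ q * exp (real k * z)" for z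
    proof -
      have "(\<Sum>i\<le>d. \<Sum>j\<le>p. of_int (c i j) * z ^ j * exp (real i * z)) =
            (\<Sum>i\<le>d. \<Sum>j\<le>p. if j = q then if i = k then real s * z ^ j * exp (real i * z) else 0 else 0)"
        by (intro sum.cong refl) (simp add: c_def)
      also have "\<dots> = (\<Sum>i\<le>d. if i = k then real s * z ^ q * exp (real i * z) else 0)"
        using \<open>q \<le> p\<close> by simp
      also have "\<dots> = real s * z ^ q * exp (real k * z)"
        using \<open>k \<le> d\<close> by simp
      finally show ?thesis .
    qed
    have "s \<le> fact p * (2 * fact d) ^ size K"
      unfolding s_def by (intro mult_mono power_mono) auto
    from of_nat_mono[OF this] have "int s \<le> fact p * (2 * fact d) ^ size K"
      by simp
    hence "\<forall>i j. \<bar>c i j\<bar> \<le> fact p * (2 * fact d) ^ size K"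
      by (auto simp: c_def)
    with id sum show ?thesis by (intro exI[of _ c]) simp
  next
    case True
    then obtain i where i: "i \<in># K" "i \<noteq> k" by blast
    define R where "R = K - {#k#} - {#i#}"
    have K: "K = add_mset k (add_mset i R)"
    proof -
      have "i \<in># K - {#k#}"
        using i by (metis insert_DiffM insert_noteq_member k)
      thus ?thesis using k by (simp add: R_def del: diff_diff_add_mset)
    qed
    define N where "N = Suc (size R)"
    have cnt: "count (add_mset k R) l \<le> Suc p" "count (add_mset i R) l \<le> Suc p" for l
      using less.prems(3)[of l] unfolding K by (auto split: if_splits)
    have "\<exists>c :: nat \<Rightarrow> nat \<Rightarrow> int. (\<forall>l j. \<bar>c l j\<bar> \<le> fact p * (2 * fact d) ^ size (add_mset k R)) \<and>
      (\<forall>z. fact p * fact d ^ size (add_mset k R) * divided_exp (add_mset k R) z =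
         (\<Sum>l\<le>d. \<Sum>j\<le>p. of_int (c l j) * z ^ j * exp (real l * z)))"
      by (rule less.IH) (use cnt less.prems(2) in \<open>auto simp: K\<close>)
    then obtain c1 :: "nat \<Rightarrow> nat \<Rightarrow> int" where c1: "\<And>l j. \<bar>c1 l j\<bar> \<le> fact p * (2 * fact d) ^ N"
      "\<And>z. fact p * fact d ^ N * divided_exp (add_mset k R) z =
         (\<Sum>l\<le>d. \<Sum>j\<le>p. of_int (c1 l j) * z ^ j * exp (real l * z))"
      by (auto simp: N_def)
    have "\<exists>c :: nat \<Rightarrow> nat \<Rightarrow> int. (\<forall>l j. \<bar>c l j\<bar> \<le> fact p * (2 * fact d) ^ size (add_mset i R)) \<and>
      (\<forall>z. fact p * fact d ^ size (add_mset i R) * divided_exp (add_mset i R) z =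
         (\<Sum>l\<le>d. \<Sum>j\<le>p. of_int (c l j) * z ^ j * exp (real l * z)))"
      by (rule less.IH) (use cnt less.prems(2) in \<open>auto simp: K\<close>)
    then obtain c2 :: "nat \<Rightarrow> nat \<Rightarrow> int" where c2: "\<And>l j. \<bar>c2 l j\<bar> \<le> fact p * (2 * fact d) ^ N"
      "\<And>z. fact p * fact d ^ N * divided_exp (add_mset i R) z =
         (\<Sum>l\<le>d. \<Sum>j\<le>p. of_int (c2 l j) * z ^ j * exp (real l * z))"
      by (auto simp: N_def)
    have le: "k \<le> d" "i \<le> d" using less.prems(2) k i by auto
    define e where "e = int k - int i"
    \<comment> \<open>A nonzero integer of absolute value at most \<open>d\<close> divides
      \<open>fact d\<close>; the cofactor \<open>f\<close> keeps the new coefficients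
      integral.\<close>
    have e: "e \<noteq> 0" "\<bar>e\<bar> \<le> int d" using i le by (auto simp: e_def)
    have "nat \<bar>e\<bar> dvd fact d"
      by (rule dvd_fact) (use e in auto)
    hence "e dvd int (fact d)" by (simp only: nat_abs_dvd_iff)
    then obtain f where f: "int (fact d) = e * f" ..
    have "\<bar>f\<bar> \<le> \<bar>e\<bar> * \<bar>f\<bar>" using e mult_right_mono[of 1 "\<bar>e\<bar>" "\<bar>f\<bar>"] by simp
    also have "\<dots> = fact d" using f by (metis abs_mult abs_of_nonneg of_nat_0_le_iff of_nat_fact)
    finally have f_le: "\<bar>f\<bar> \<le> fact d" .
    define c where "c = (\<lambda>l j. f * (c1 l j - c2 l j))"
    have size: "size K = Suc N" by (simp add: K N_def)
    have "\<bar>c l j\<bar> \<le> fact p * (2 * fact d) ^ size K" for l j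
    proof -
      have "\<bar>c1 l j - c2 l j\<bar> \<le> 2 * (fact p * (2 * fact d) ^ N)"
        using c1(1)[of l j] c2(1)[of l j] by linarith
      hence "\<bar>f\<bar> * \<bar>c1 l j - c2 l j\<bar> \<le> fact d * (2 * (fact p * (2 * fact d) ^ N))"
        using f_le by (intro mult_mono) auto
      thus ?thesis by (simp add: c_def abs_mult size mult_ac)
    qed
    moreover have "fact p * fact d ^ size K * divided_exp K z =
         (\<Sum>l\<le>d. \<Sum>j\<le>p. of_int (c l j) * z ^ j * exp (real l * z))" for z
    proof -
      have "(fact d :: real) = of_int (int (fact d))" by simp
      also have "\<dots> = of_int f * (real k - real i)"
        unfolding f by (simp add: e_def)
      finally have fd: "(fact d :: real) = of_int f * (real k - real i)" .
      have "fact p * fact d ^ size K * divided_exp K z = fact p * fact d ^ N * fact d * divided_exp K z"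
        by (simp add: size mult_ac)
      also have "\<dots> = fact p * fact d ^ N * of_int f * ((real k - real i) * divided_exp K z)"
        by (simp only: fd mult.assoc)
      also have "(real k - real i) * divided_exp K z =
                 divided_exp (add_mset k R) z - divided_exp (add_mset i R) z"
        unfolding K by (rule divided_exp_recursion)
      also have "fact p * fact d ^ N * of_int f * \<dots> =
          of_int f * (fact p * fact d ^ N * divided_exp (add_mset k R) z -
                      fact p * fact d ^ N * divided_exp (add_mset i R) z)"
        by (simp add: algebra_simps)
      also have "\<dots> = (\<Sum>l\<le>d. \<Sum>j\<le>p. of_int (c l j) * z ^ j * exp (real l * z))"
        unfolding c1(2) c2(2)
        by (simp add: c_def sum_distrib_left flip: sum_subtractf) (simp add: algebra_simps)
      finally show ?thesis .
    qed
    ultimately show ?thesis by (intro exI[of _ c]) blast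
  qed
qed

section \<open>The Hermite--Lindemann theorem for real numbers\<close>

lemma fact_power_le_fact_mult: "(fact p :: nat) ^ m \<le> fact (m * p)"
proof (induction m)
  case (Suc m)
  have "(fact p :: nat) ^ Suc m \<le> fact p * fact (m * p)" using Suc by simp
  also have "\<dots> \<le> fact (p + m * p)"
    by (rule dvd_imp_le[OF fact_fact_dvd_fact]) simp
  finally show ?case by simp
qed simp

lemma size_repeat_mset_atMost: "size (repeat_mset (Suc p) (mset_set {..d :: nat})) = Suc d * Suc p"
  by (simp add: mult.commute)

text \<open>It serves to absorb constants into powers with exponent \<open>Suc p\<close>.\<close>

lemma power_le_Suc_power:
  fixes x :: "'a :: linordered_semidom"
  shows "1 \<le> x \<Longrightarrow> x \<le> x ^ Suc p"
  by (metis power_increasing power_one_right Suc_le_mono le0 One_nat_def)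

text \<open>
  The witness is the divided difference of \<open>\<lambda>t. exp (t * \<alpha>)\<close> at the nodes
  \<open>0, \<dots>, d\<close>, each taken \<open>p + 1\<close> times, cleared of denominators.
\<close>
lemma small_exponential_form:
  fixes \<alpha> \<beta> :: real and a b :: int
  assumes "\<alpha> > 0" "a \<noteq> 0" "b \<noteq> 0" "finite I" "H \<ge> 1" "card I > 0" "\<beta> = exp \<alpha>"
    and act: "acts_by_integers I v (of_int a * \<alpha>) H" "acts_by_integers I v (of_int b * \<beta>) H"
  obtains B Q :: int where "B \<ge> 1" "Q \<ge> 1"
    "\<And>p. \<exists>x. x \<noteq> 0 \<and> \<bar>x\<bar> * fact p ^ d \<le> of_int Q ^ Suc p \<and>
       acts_by_integers I v x (fact p * B ^ Suc p)"
proof -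
  define n where "n = int (card I)"
  have "n \<ge> 1" using assms by (simp add: n_def)
  have a1: "\<bar>a\<bar> \<ge> 1" and b1: "\<bar>b\<bar> \<ge> 1" using assms by auto
  define D where "D = (2 * fact d :: int)"
  have "D \<ge> 1" using fact_ge_1[of d, where 'a = int] unfolding D_def by linarith
  have nH: "n * H \<ge> 1" using \<open>n \<ge> 1\<close> \<open>H \<ge> 1\<close> mult_mono[of 1 n 1 H] by simp
  \<comment> \<open>\<open>B\<close> and \<open>Q\<close> collect the bases that remain once every
    factor except the factorials of \<open>p\<close> is bounded by a power with exponent
    \<open>Suc p\<close>. The 2 in \<open>B\<close> comes from
    \<open>Suc p \<le> 2 ^ Suc p\<close>.\<close>
  define B where "B = int (Suc d) * 2 * D ^ Suc d * \<bar>a\<bar> * \<bar>b\<bar> ^ d * (n * n) * (n * H) ^ Suc d"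
  define A where "A = max 1 \<alpha>"
  define E where "E = exp (2 * real d * \<alpha>)"
  define Q where "Q = \<lceil>\<bar>of_int a\<bar> * \<bar>of_int b\<bar> ^ d * (of_int D * A) ^ Suc d * E\<rceil>"
  have "B \<ge> 1"
    unfolding B_def using a1 b1 \<open>D \<ge> 1\<close> \<open>n \<ge> 1\<close> nH
    by (simp add: int_one_le_iff_zero_less)
  have QQ: "\<bar>of_int a\<bar> * \<bar>of_int b\<bar> ^ d * (of_int D * A) ^ Suc d * E \<le> of_int Q"
    unfolding Q_def by (rule le_of_int_ceiling)
  have "A \<ge> 1" "E \<ge> 1" using assms(1) by (auto simp: A_def E_def)
  have "0 < \<bar>of_int a\<bar> * \<bar>of_int b\<bar> ^ d * (of_int D * A) ^ Suc d * E"
    using a1 b1 \<open>D \<ge> 1\<close> \<open>A \<ge> 1\<close> \<open>E \<ge> 1\<close> by (auto intro!: mult_pos_pos)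
  hence "Q \<ge> 1" unfolding Q_def by linarith
  have "\<exists>x. x \<noteq> 0 \<and> \<bar>x\<bar> * fact p ^ d \<le> of_int Q ^ Suc p \<and>
       acts_by_integers I v x (fact p * B ^ Suc p)" for p
  proof -
    define K where "K = repeat_mset (Suc p) (mset_set {..d})"
    define W where "W = Suc d * Suc p"
    have size: "size K = W" unfolding K_def W_def by (rule size_repeat_mset_atMost)
    hence "K \<noteq> {#}" by (auto simp: W_def)
    have count: "count K k = (if k \<le> d then Suc p else 0)" for k
      by (simp add: K_def count_mset_set' del: repeat_mset_Suc)
    have K_le: "k \<le> d" if "k \<in># K" for k
      using that count[of k] by (auto simp flip: count_greater_zero_iff split: if_splits)
    have "count K k \<le> Suc p" for k by (simp add: count)
    with \<open>K \<noteq> {#}\<close> K_le obtain c :: "nat \<Rightarrow> nat \<Rightarrow> int" where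
      c: "\<And>k j. \<bar>c k j\<bar> \<le> fact p * D ^ W"
      and eq: "\<And>z. fact p * fact d ^ W * divided_exp K z =
         (\<Sum>k\<le>d. \<Sum>j\<le>p. of_int (c k j) * z ^ j * exp (real k * z))"
      using divided_exp_expansion[of K d p] unfolding size D_def by auto
    \<comment> \<open>The factor a^p b^d suffices to rewrite every \<alpha>^j \<beta>^k with j \<le>
      p, k \<le> d in terms of \<open>a * \<alpha>\<close> and \<open>b * \<beta>\<close>.\<close>
    define x where "x = of_int a ^ p * of_int b ^ d * (fact p * fact d ^ W * divided_exp K \<alpha>)"
    have "x \<noteq> 0"
      using divided_exp_pos[OF assms(1), of K] assms by (simp add: x_def)

    have "\<bar>x\<bar> = \<bar>of_int a\<bar> ^ p * \<bar>of_int b\<bar> ^ d * (fact p * fact d ^ W * divided_exp K \<alpha>)"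
      using divided_exp_pos[OF assms(1), of K] by (simp add: x_def abs_mult power_abs)
    also have "divided_exp K \<alpha> \<le> 2 ^ W * \<alpha> ^ (W - 1) / fact (W - 1) * E"
      using divided_exp_le[OF K_le assms(1), of K] by (simp add: size E_def)
    \<comment> \<open>Here W - 1 = (d + 1) p + d, so the factorial in the denominator is at least
      (p!)^(d+1). Replacing \<alpha> by \<open>A \<ge> 1\<close> allows the exponent to be raised to
      \<open>W\<close>.\<close>
    also have "2 ^ W * \<alpha> ^ (W - 1) / fact (W - 1) * E \<le> 2 ^ W * A ^ W / fact p ^ Suc d * E"
    proof (intro mult_right_mono frac_le mult_left_mono)
      have "\<alpha> ^ (W - 1) \<le> A ^ (W - 1)" using assms(1) by (intro power_mono) (auto simp: A_def)
      also have "\<dots> \<le> A ^ W" using \<open>A \<ge> 1\<close> by (intro power_increasing) auto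
      finally show "\<alpha> ^ (W - 1) \<le> A ^ W" .
      have "(fact p :: nat) ^ Suc d \<le> fact (Suc d * p)" by (rule fact_power_le_fact_mult)
      also have "\<dots> \<le> fact (W - 1)" by (intro fact_mono_nat) (simp add: W_def)
      finally show "(fact p :: real) ^ Suc d \<le> fact (W - 1)"
        by (metis of_nat_fact of_nat_le_iff of_nat_power)
    qed (use \<open>E \<ge> 1\<close> \<open>A \<ge> 1\<close> in auto)
    finally have "\<bar>x\<bar> \<le> \<bar>of_int a\<bar> ^ p * \<bar>of_int b\<bar> ^ d *
        (fact p * fact d ^ W * (2 ^ W * A ^ W / fact p ^ Suc d * E))"
      by (simp add: mult_left_mono)
    hence "\<bar>x\<bar> * fact p ^ d \<le> \<bar>of_int a\<bar> ^ p * \<bar>of_int b\<bar> ^ d *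
        (fact p * fact d ^ W * (2 ^ W * A ^ W / fact p ^ Suc d * E)) * fact p ^ d"
      by (rule mult_right_mono) simp
    \<comment> \<open>The factor p! of \<open>x\<close> and the extra (p!)^d cancel the denominator
      exactly.\<close>
    also have "\<dots> = \<bar>of_int a\<bar> ^ p * \<bar>of_int b\<bar> ^ d * ((of_int D * A) ^ W * E)"
      by (simp add: D_def power_mult_distrib field_simps)
    also have "\<dots> \<le> \<bar>of_int a\<bar> ^ Suc p * (\<bar>of_int b\<bar> ^ d) ^ Suc p *
       (((of_int D * A) ^ Suc d) ^ Suc p * E ^ Suc p)"
    proof (intro mult_mono)
      show "\<bar>real_of_int a\<bar> ^ p \<le> \<bar>real_of_int a\<bar> ^ Suc p"
        using a1 by (intro power_increasing) linarith+
      have "1 \<le> \<bar>real_of_int b\<bar> ^ d" using b1 by (intro one_le_power) linarith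
      thus "\<bar>real_of_int b\<bar> ^ d \<le> (\<bar>real_of_int b\<bar> ^ d) ^ Suc p" by (rule power_le_Suc_power)
      show "E \<le> E ^ Suc p" using \<open>E \<ge> 1\<close> by (rule power_le_Suc_power)
      show "(real_of_int D * A) ^ W \<le> ((real_of_int D * A) ^ Suc d) ^ Suc p"
        by (simp only: W_def power_mult order_refl)
    qed (use \<open>E \<ge> 1\<close> \<open>A \<ge> 1\<close> \<open>D \<ge> 1\<close> in auto)
    also have "\<dots> = (\<bar>of_int a\<bar> * \<bar>of_int b\<bar> ^ d * (of_int D * A) ^ Suc d * E) ^ Suc p"
      by (simp only: power_mult_distrib mult.assoc)
    also have "\<dots> \<le> of_int Q ^ Suc p"
      using QQ \<open>E \<ge> 1\<close> \<open>A \<ge> 1\<close> \<open>D \<ge> 1\<close> by (intro power_mono) auto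
    finally have small: "\<bar>x\<bar> * fact p ^ d \<le> of_int Q ^ Suc p" .

    have x_eq: "x = (\<Sum>k\<le>d. \<Sum>j\<le>p. of_int (c k j * a ^ (p - j) * b ^ (d - k)) *
        ((of_int a * \<alpha>) ^ j * (of_int b * \<beta>) ^ k))"
    proof -
      have "x = (\<Sum>k\<le>d. \<Sum>j\<le>p. of_int a ^ p * of_int b ^ d *
              (of_int (c k j) * \<alpha> ^ j * exp (real k * \<alpha>)))"
        unfolding x_def eq by (simp add: sum_distrib_left)
      also have "\<dots> = (\<Sum>k\<le>d. \<Sum>j\<le>p. of_int (c k j * a ^ (p - j) * b ^ (d - k)) *
              ((of_int a * \<alpha>) ^ j * (of_int b * \<beta>) ^ k))"
      proof (intro sum.cong refl)
        fix k j assume "k \<in> {..d}" "j \<in> {..p}"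
        hence "of_int a ^ p = of_int a ^ (p - j) * (of_int a ^ j :: real)"
          "of_int b ^ d = of_int b ^ (d - k) * (of_int b ^ k :: real)"
          by (simp_all flip: power_add)
        moreover have "exp (real k * \<alpha>) = \<beta> ^ k"
          unfolding \<open>\<beta> = exp \<alpha>\<close> by (rule exp_of_nat_mult)
        ultimately show "of_int a ^ p * of_int b ^ d * (of_int (c k j) * \<alpha> ^ j * exp (real k * \<alpha>)) =
            of_int (c k j * a ^ (p - j) * b ^ (d - k)) * ((of_int a * \<alpha>) ^ j * (of_int b * \<beta>) ^ k)"
          by (simp add: power_mult_distrib mult_ac)
      qed
      finally show ?thesis .
    qed
    \<comment> \<open>The factor \<open>n\<close> in \<open>T\<close> stems from multiplying the two
      powers; the further \<open>n\<close> in \<open>n * T\<close> from multiplying by the integer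
      coefficient.\<close>
    define T where "T = fact p * D ^ W * \<bar>a\<bar> ^ p * \<bar>b\<bar> ^ d * n * (n * H) ^ (p + d)"
    have summand: "acts_by_integers I v (of_int (c k j * a ^ (p - j) * b ^ (d - k)) *
        ((of_int a * \<alpha>) ^ j * (of_int b * \<beta>) ^ k)) (n * T)" if "k \<le> d" "j \<le> p" for k j
    proof (rule acts_by_integers_mono)
      show "acts_by_integers I v (of_int (c k j * a ^ (p - j) * b ^ (d - k)) *
        ((of_int a * \<alpha>) ^ j * (of_int b * \<beta>) ^ k))
        (int (card I) * \<bar>c k j * a ^ (p - j) * b ^ (d - k)\<bar> *
          (int (card I) * (int (card I) * H) ^ j * (int (card I) * H) ^ k))"
        using assms(4) act
        by (intro acts_by_integers_mult acts_by_integers_of_int acts_by_integers_power)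
      have "\<bar>c k j * a ^ (p - j) * b ^ (d - k)\<bar> \<le> fact p * D ^ W * \<bar>a\<bar> ^ p * \<bar>b\<bar> ^ d"
        unfolding abs_mult power_abs using a1 b1 c[of k j] \<open>D \<ge> 1\<close>
        by (intro mult_mono power_increasing) auto
      moreover have "n * (n * H) ^ j * (n * H) ^ k \<le> n * (n * H) ^ (p + d)"
        unfolding mult.assoc power_add[symmetric] using nH that \<open>n \<ge> 1\<close>
        by (intro mult_left_mono power_increasing) auto
      ultimately have "\<bar>c k j * a ^ (p - j) * b ^ (d - k)\<bar> * (n * (n * H) ^ j * (n * H) ^ k) \<le>
          (fact p * D ^ W * \<bar>a\<bar> ^ p * \<bar>b\<bar> ^ d) * (n * (n * H) ^ (p + d))"
        by (rule mult_mono) (use \<open>n \<ge> 1\<close> nH \<open>D \<ge> 1\<close> in auto)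
      also have "\<dots> = T" by (simp add: T_def mult_ac)
      finally show "int (card I) * \<bar>c k j * a ^ (p - j) * b ^ (d - k)\<bar> *
          (int (card I) * (int (card I) * H) ^ j * (int (card I) * H) ^ k) \<le> n * T"
        using \<open>n \<ge> 1\<close> by (simp only: n_def[symmetric] mult.assoc) (intro mult_left_mono, auto)
    qed
    have "acts_by_integers I v x (\<Sum>k\<le>d. \<Sum>j\<le>p. n * T)"
      unfolding x_eq by (intro acts_by_integers_sum assms(4) summand) auto
    moreover have "(\<Sum>k\<le>d. \<Sum>j\<le>p. n * T) \<le> fact p * B ^ Suc p"
    proof -
      have D_pow: "D ^ W = (D ^ Suc d) ^ Suc p"
        by (simp only: W_def power_mult)
      have "(\<Sum>k\<le>d. \<Sum>j\<le>p. n * T) = fact p * (int (Suc d) * int (Suc p) * (D ^ Suc d) ^ Suc p *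
          \<bar>a\<bar> ^ p * \<bar>b\<bar> ^ d * (n * n) * (n * H) ^ (p + d))"
        by (simp add: T_def D_pow mult_ac del: power_Suc)
      also have "\<dots> \<le> fact p * (int (Suc d) ^ Suc p * 2 ^ Suc p * (D ^ Suc d) ^ Suc p *
          \<bar>a\<bar> ^ Suc p * (\<bar>b\<bar> ^ d) ^ Suc p * (n * n) ^ Suc p * ((n * H) ^ Suc d) ^ Suc p)"
      proof (intro mult_left_mono[of _ _ "fact p"] mult_mono)
        show "int (Suc d) \<le> int (Suc d) ^ Suc p" by (rule power_le_Suc_power) simp
        have "Suc p \<le> 2 ^ Suc p" by (rule less_imp_le[OF less_exp])
        thus "int (Suc p) \<le> 2 ^ Suc p"
          by (metis of_nat_le_iff of_nat_numeral of_nat_power)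
        show "\<bar>a\<bar> ^ p \<le> \<bar>a\<bar> ^ Suc p" using a1 by (intro power_increasing) auto
        show "\<bar>b\<bar> ^ d \<le> (\<bar>b\<bar> ^ d) ^ Suc p"
          using b1 by (intro power_le_Suc_power one_le_power)
        show "n * n \<le> (n * n) ^ Suc p"
          using \<open>n \<ge> 1\<close> mult_mono[of 1 n 1 n] by (intro power_le_Suc_power) auto
        show "(n * H) ^ (p + d) \<le> ((n * H) ^ Suc d) ^ Suc p"
          unfolding power_mult[symmetric] using nH by (intro power_increasing) auto
      qed (use \<open>n \<ge> 1\<close> nH \<open>D \<ge> 1\<close> in auto)
      also have "\<dots> = fact p * (int (Suc d) * 2 * D ^ Suc d * \<bar>a\<bar> * \<bar>b\<bar> ^ d * (n * n) * (n * H) ^ Suc d) ^ Suc p"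
        by (simp only: power_mult_distrib mult.assoc)
      finally show ?thesis by (simp only: B_def)
    qed
    ultimately show ?thesis
      using \<open>x \<noteq> 0\<close> small acts_by_integers_mono by blast
  qed
  thus ?thesis using that \<open>B \<ge> 1\<close> \<open>Q \<ge> 1\<close> by blast
qed

text \<open>The Liouville inequality loses (p!)^n, where n is the matrix size, while the auxiliary
  number has size about 1/(p!)^d. With d = n + 1 one factor 1/p! survives and beats every geometric
  factor.\<close>

lemma exp_transcendental_pos:
  fixes \<alpha> :: real
  assumes "\<alpha> > 0" "algebraic \<alpha>"
  shows "\<not> algebraic (exp \<alpha>)"
proof
  assume "algebraic (exp \<alpha>)"
  then obtain a b :: int and I :: "(nat \<times> nat) set" and v H i0 where
    I: "a \<noteq> 0" "b \<noteq> 0" "finite I" "i0 \<in> I" "v i0 \<noteq> 0" "H \<ge> 1"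
    "acts_by_integers I v (of_int a * \<alpha>) H" "acts_by_integers I v (of_int b * exp \<alpha>) H"
    by (rule algebraic_common_action[OF assms(2)])
  define n where "n = card I"
  have "n > 0" using I by (auto simp: n_def card_gt_0_iff)
  obtain B Q :: int where BQ: "B \<ge> 1" "Q \<ge> 1"
    and x: "\<And>p. \<exists>x. x \<noteq> 0 \<and> \<bar>x\<bar> * fact p ^ Suc n \<le> of_int Q ^ Suc p \<and>
       acts_by_integers I v x (fact p * B ^ Suc p)"
    by (rule small_exponential_form[OF assms(1) I(1,2,3,6) _ refl I(7,8), of "Suc n"])
       (use \<open>n > 0\<close> n_def in auto)
  define R where "R = real_of_int (Q * B ^ n)"
  \<comment> \<open>The factor 2^n comes from bounding 1 + h by 2h for h \<ge> 1; the extra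
    \<open>R\<close> reduces the exponent \<open>Suc p\<close> to \<open>p\<close>.\<close>
  define C where "C = fact n * 2 ^ n * R"
  have bound: "1 \<le> C * (R ^ p / fact p)" for p
  proof -
    obtain x where x: "x \<noteq> 0" "\<bar>x\<bar> * fact p ^ Suc n \<le> of_int Q ^ Suc p"
       "acts_by_integers I v x (fact p * B ^ Suc p)"
      using x by blast
    have HB: "fact p * B ^ Suc p \<ge> 1"
      using BQ(1) fact_ge_1[of p, where 'a = int] mult_mono[of 1 "fact p :: int" 1 "B ^ Suc p"]
        one_le_power[of B "Suc p"] by simp
    have "1 \<le> \<bar>x\<bar> * (fact n * (1 + of_int (fact p * B ^ Suc p)) ^ n)"
      unfolding n_def by (rule acts_by_integers_liouville[OF x(3) I(3-5) _ x(1)]) (use HB in simp)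
    also have "\<dots> \<le> \<bar>x\<bar> * (fact n * (2 * of_int (fact p * B ^ Suc p)) ^ n)"
    proof (intro mult_left_mono power_mono)
      have "1 \<le> real_of_int (fact p * B ^ Suc p)" using HB by (simp only: of_int_1_le_iff)
      thus "1 + real_of_int (fact p * B ^ Suc p) \<le> 2 * of_int (fact p * B ^ Suc p)"
        "0 \<le> 1 + real_of_int (fact p * B ^ Suc p)" by linarith+
    qed auto
    also have "\<dots> = (\<bar>x\<bar> * fact p ^ Suc n) * (fact n * 2 ^ n * (of_int B ^ n) ^ Suc p) / fact p"
      by (simp add: power_mult_distrib flip: power_mult) (simp add: mult.commute power_add)
    also have "\<dots> \<le> of_int Q ^ Suc p * (fact n * 2 ^ n * (of_int B ^ n) ^ Suc p) / fact p"
      using BQ by (intro divide_right_mono mult_right_mono x(2)) auto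
    also have "\<dots> = C * (R ^ p / fact p)"
      by (simp add: C_def R_def power_mult_distrib)
    finally show ?thesis .
  qed
  have "(\<lambda>p. R ^ p / fact p) \<longlonglongrightarrow> 0"
    using summable_LIMSEQ_zero[OF sums_summable[OF sums_exp_power[of R]]] .
  hence "(\<lambda>p. C * (R ^ p / fact p)) \<longlonglongrightarrow> C * 0"
    by (intro tendsto_mult_left)
  from LIMSEQ_le_const[OF this, of 1] bound show False by auto
qed

theorem hermite_lindemann_real:
  fixes \<alpha> :: real
  assumes "\<alpha> \<noteq> 0" "algebraic \<alpha>"
  shows "\<not> algebraic (exp \<alpha>)"
proof (cases "\<alpha> > 0")
  case False
  have "\<not> algebraic (exp (- \<alpha>))"
    by (rule exp_transcendental_pos) (use False assms in auto)
  thus ?thesis using algebraic_inverse[of "exp \<alpha>"] by (auto simp: exp_minus)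
qed (use exp_transcendental_pos assms in blast)

lemma transcendental_ln:
  fixes x :: real
  assumes "x > 0" "x \<noteq> 1" "algebraic x"
  shows "\<not> algebraic (ln x)"
  using hermite_lindemann_real[of "ln x"] assms by auto

section \<open>Exceptions\<close>

text \<open>For x = r/s the number w = exp(i pi x) is a root of unity, as w^(2s) = 1, and the sine
  is (w - cnj w) / (2i).\<close>

lemma algebraic_sin_pi_rat:
  fixes x :: real
  assumes "x \<in> \<rat>"
  shows "algebraic (sin (pi * x))"
proof -
  obtain r s :: int where rs: "s > 0" "x = of_int r / of_int s"
    using assms by (rule Rats_cases')
  define w where "w = cis (pi * x)"
  have "w ^ (2 * nat s) = cis (real (2 * nat s) * (pi * x))"
    by (simp add: w_def Complex.DeMoivre)
  also have "real (2 * nat s) * (pi * x) = 2 * pi * of_int r"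
    using rs by (simp add: field_simps)
  also have "cis \<dots> = 1"
    by (rule cis_multiple_2pi) simp
  finally have "w ^ (2 * nat s) = 1" .
  with rs have w: "algebraic w"
    by - (rule algebraic_root[of 1 "monom 1 (2 * nat s)"], auto simp: poly_monom degree_monom_eq rat_imp_algebraic)
  hence "algebraic (inverse (2 * \<i>) * (w - cnj w))"
    by (intro algebraic_mult algebraic_inverse algebraic_diff algebraic_cnj algebraic_ii)
       (auto simp: rat_imp_algebraic)
  also have "inverse (2 * \<i>) * (w - cnj w) = of_real (sin (pi * x))"
    by (simp add: w_def complex_eq_iff)
  finally show ?thesis by simp
qed

text \<open>At integers both sides are 0 by convention: one Gamma factor sits at a pole and the
  right side divides by zero.\<close>

lemma Gamma_reflection_real:
  fixes x :: real
  shows "Gamma x * Gamma (1 - x) = pi / sin (pi * x)"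
proof -
  have "complex_of_real (Gamma x * Gamma (1 - x)) = complex_of_real (pi / sin (pi * x))"
    using Gamma_reflection_complex[of "complex_of_real x"]
    by (simp only: of_real_mult of_real_divide of_real_diff of_real_1 Gamma_complex_of_real[symmetric]
        sin_of_real[symmetric])
  thus ?thesis by (simp only: of_real_eq_iff)
qed

lemma ln_Gamma_reflection:
  fixes x :: real
  assumes "0 < x" "x < 1"
  shows "ln (Gamma x) + ln (Gamma (1 - x)) = ln pi - ln (sin (pi * x))"
proof -
  have "sin (pi * x) > 0" using assms by (intro sin_gt_zero) auto
  have "ln (Gamma x) + ln (Gamma (1 - x)) = ln (Gamma x * Gamma (1 - x))"
    using assms by (intro ln_mult_pos[symmetric] Gamma_real_pos) auto
  also have "Gamma x * Gamma (1 - x) = pi / sin (pi * x)"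
    by (rule Gamma_reflection_real)
  also have "ln \<dots> = ln pi - ln (sin (pi * x))"
    using \<open>sin (pi * x) > 0\<close> by (intro ln_divide_pos) auto
  finally show ?thesis .
qed

text \<open>The difference of the sines is a product of a sine and a cosine. In the given range the
  sine factor vanishes only for x = y, the cosine factor only for x + y = 1.\<close>

lemma sin_pi_mult_eqD:
  fixes x y :: real
  assumes "0 < x" "x < 1" "0 < y" "y < 1" "sin (pi * x) = sin (pi * y)"
  shows "y = x \<or> y = 1 - x"
proof -
  have "2 * sin ((pi * x - pi * y) / 2) * cos ((pi * x + pi * y) / 2) = 0"
    using assms(5) sin_diff_sin[of "pi * x" "pi * y"] by simp
  then consider "sin (pi * ((x - y) / 2)) = 0" | "cos (pi * ((x + y) / 2)) = cos (pi * (1 / 2))"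
    by (auto simp: algebra_simps)
  thus ?thesis
  proof cases
    case 1
    have "- 1 < (x - y) / 2" "(x - y) / 2 < 1" using assms by auto
    hence "pi * (- 1) < pi * ((x - y) / 2)" "pi * ((x - y) / 2) < pi * 1"
      by (intro mult_strict_left_mono; simp)+
    hence "pi * ((x - y) / 2) = 0" using sin_eq_0_pi[OF _ _ 1] by simp
    thus ?thesis by simp
  next
    case 2
    have "pi * ((x + y) / 2) \<le> pi * 1" using assms by (intro mult_left_mono) auto
    hence "pi * ((x + y) / 2) = pi * (1 / 2)"
      using assms by (intro cos_inj_pi[OF _ _ _ _ 2]) auto
    thus ?thesis by simp
  qed
qed

theorem mainTheorem2:
  defines "P1 \<equiv> exceptions = {} \<and> \<not> algebraic (ln pi)"
      and "P2 \<equiv> exceptions = {1/2} \<and> algebraic (ln pi)"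
      and "P3 \<equiv> finite exceptions \<and> card exceptions = 2 \<and> (1/2::real) \<notin> exceptions
                 \<and> \<not> algebraic (ln pi)"
  shows "(P1 \<or> P2 \<or> P3) \<and> \<not> (P1 \<and> P2) \<and> \<not> (P1 \<and> P3) \<and> \<not> (P2 \<and> P3)"
proof -
  have exc: "x \<in> exceptions \<longleftrightarrow> x \<in> \<rat> \<and> 0 < x \<and> x < 1 \<and> algebraic (ln pi - ln (sin (pi * x)))" for x
    using ln_Gamma_reflection[of x] by (auto simp: exceptions_def exception_def)
  \<comment> \<open>At 1/2 the sine is 1 and its logarithm 0.\<close>
  have half: "1/2 \<in> exceptions \<longleftrightarrow> algebraic (ln pi)"
    by (simp add: exc)
  have refl: "1 - x \<in> exceptions" if "x \<in> exceptions" for x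
  proof -
    have "sin (pi * (1 - x)) = sin (pi * x)" by (simp add: right_diff_distrib)
    thus ?thesis using that by (simp add: exc)
  qed
  have uniq: "y = x \<or> y = 1 - x" if x: "x \<in> exceptions" and y: "y \<in> exceptions" for x y
  proof -
    have pos: "sin (pi * x) > 0" "sin (pi * y) > 0"
      using x y by (auto simp: exc intro!: sin_gt_zero)
    define q where "q = sin (pi * x) / sin (pi * y)"
    have "algebraic q"
      unfolding q_def divide_inverse using x y
      by (intro algebraic_mult algebraic_inverse algebraic_sin_pi_rat) (auto simp: exc)
    \<comment> \<open>The unknown \<open>ln pi\<close> cancels, leaving the logarithm of the
      algebraic number \<open>q\<close>.\<close>
    moreover have "algebraic ((ln pi - ln (sin (pi * y))) - (ln pi - ln (sin (pi * x))))"
      using x y unfolding exc by (intro algebraic_diff[of "ln pi - _" "ln pi - _"]) auto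
    hence "algebraic (ln q)" using pos by (simp add: q_def ln_divide_pos)
    moreover have "q > 0" using pos by (simp add: q_def)
    ultimately have "q = 1" using transcendental_ln by blast
    hence "sin (pi * x) = sin (pi * y)" using pos by (simp add: q_def)
    thus ?thesis using sin_pi_mult_eqD[of x y] x y by (simp add: exc)
  qed
  have "P1 \<or> P2 \<or> P3"
  proof (cases "exceptions = {}")
    case True
    thus ?thesis using half by (simp add: P1_def)
  next
    case False
    then obtain x where x: "x \<in> exceptions" by blast
    \<comment> \<open>This set is a singleton exactly when x = 1/2, which separates the last two
      cases.\<close>
    have E: "exceptions = {x, 1 - x}" using x refl[OF x] uniq[OF x] by blast
    show ?thesis
    proof (cases "x = 1/2")
      case True
      have "algebraic (ln pi)" using half x True by simp
      thus ?thesis unfolding P2_def E True by simp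
    next
      case False
      hence "1/2 \<notin> exceptions" "card exceptions = 2" "finite exceptions" unfolding E by auto
      thus ?thesis using half by (simp add: P3_def)
    qed
  qed
  thus ?thesis by (auto simp: P1_def P2_def P3_def)
qed

end
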